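(* Let $\phi\in(0,\pi/2)$ and suppose $\mathbf{M}H_\phi^{-1}\mathbf{N}^{-1}$ is diagonalizable (over $\mathbb{C}$) with eigenvalues $\lambda_{\phi 1},\dots,\lambda_{\phi d}$, a basis of right eigenvectors $V_{\phi1},\dots,V_{\phi d}$ and corresponding left eigenvectors $W_{\phi1}^\top,\dots,W_{\phi d}^\top$ normalized so that $W_{\phi i}^\top V_{\phi k}=\delta_{ik}$. Suppose it has a negative real eigenvalue $\lambda_{\phi j}<0$, and let $\mathcal{J}=\{i:\lambda_{\phi i}=\lambda_{\phi j}\}$. Define $$\mathbf{u}_{\phi j}^{\mathrm{fin}}=\sum_{i\notin\mathcal{J}}W_{\phi i}\Big(1+\tfrac{\lambda_{\phi i}}{|\lambda_{\phi j}|}\Big)^{-1}V_{\phi i}^\top\big[\mathbf{u}_{\mathrm A}-\mathbf{u}_{\mathrm N}\big],\qquad \mathbf{u}_{\phi j}^{\mathrm{inf}}=\sum_{i\in\mathcal{J}}W_{\phi i}V_{\phi i}^\top\big[\mathbf{u}_{\mathrm A}-\mathbf{u}_{\mathrm N}\big].$$ Then the asymptotic behaviour of $\Gamma_\phi(t)$ as $t\to|\lambda_{\phi j}|$ is $$\Gamma_\phi(t)\ \sim\ \mathbf{u}_{\mathrm N}+\mathbf{u}_{\phi j}^{\mathrm{fin}}+\Big(1+\tfrac{\lambda_{\phi j}}{t}\Big)^{-1}\mathbf{u}_{\phi j}^{\mathrm{inf}},$$ in the sense that $$\lim_{t\to|\lambda_{\phi j}|,\ t\neq|\lambda_{\phi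 j}|}\Big[\Gamma_\phi(t)-\Big(1+\tfrac{\lambda_{\phi j}}{t}\Big)^{-1}\mathbf{u}_{\phi j}^{\mathrm{inf}}\Big]=\mathbf{u}_{\mathrm N}+\mathbf{u}_{\phi j}^{\mathrm{fin}} .$$
   Context: Two-player quadratic game: $d_1,d_2\ge 1$, $d=d_1+d_2$, costs $J_i(u)=\tfrac12u^\top M_iu+c_i^\top u$ on $\mathbb{R}^{d_1}\times\mathbb{R}^{d_2}$, with symmetric real matrices $$M_1=\begin{bmatrix} A_1 & B_1^\top \\ B_1 & D_1 \end{bmatrix},\quad M_2=\begin{bmatrix} D_2 & B_2 \\ B_2^\top & A_2 \end{bmatrix},\quad c_1=\begin{bmatrix} a_1 \\ b_1 \end{bmatrix},\quad c_2=\begin{bmatrix} b_2 \\ a_2 \end{bmatrix},$$ where $A_1,D_2\in\mathbb{R}^{d_1\times d_1}$, $A_2,D_1\in\mathbb{R}^{d_2\times d_2}$, $B_1\in\mathbb{R}^{d_2\times d_1}$, $B_2\in\mathbb{R}^{d_1\times d_2}$, $a_1,b_2\in\mathbb{R}^{d_1}$, $a_2,b_1\in\mathbb{R}^{d_2}$. Put $$\mathbf{M}=\begin{bmatrix} A_1 & B_2 \\ B_1 & A_2 \end{bmatrix},\quad \mathbf{N}=\begin{bmatrix} D_2 & B_1^\top \\ B_2^\top & D_1 \end{bmatrix},\quad \mathbf{a}=\begin{bmatrix} a_1 \\ a_2 \end{bmatrix},\quad \mathbf{b}=\begin{bmatrix} b_2 \\ b_1 \end{bmatrix}.$$ Standing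 assumptions: $A_1,A_2\succ0$, and $M_1,M_2,\mathbf{M},\mathbf{N}$ are invertible. Define $\mathbf{u}_{\mathrm N}^\top=-\mathbf{a}^\top\mathbf{M}^{-1}$ (Nash) and $\mathbf{u}_{\mathrm A}^\top=-\mathbf{b}^\top\mathbf{N}^{-1}$ (altruistic Nash). For $\phi\in(0,\pi/2)$ let $H_\phi=\mathrm{blkdiag}(\cos\phi I_{d_1},\sin\phi I_{d_2})$, and for $t>0$ such that the inverse exists let $$G_\phi(t)=\big[\tfrac1t\mathbf{M}H_\phi^{-1}\mathbf{N}^{-1}+I\big]^{-\top},\qquad \Gamma_\phi(t)=\mathbf{u}_{\mathrm N}+G_\phi(t)[\mathbf{u}_{\mathrm A}-\mathbf{u}_{\mathrm N}].$$ ($\Gamma_\phi(t)$ is the Nash equilibrium when player $i$ minimizes $\cos\theta_iJ_i+\sin\theta_iJ_{-i}$ with $\tan\theta_1=t\cos\phi$, $\tan\theta_2=t\sin\phi$.) *)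

theory Defs
  imports "HOL-Analysis.Analysis"
begin

text \<open>Vectors on the product of the two action spaces are indexed by the sum type
  \<open>'m + 'n\<close>, where \<open>CARD('m)\<close> and \<open>CARD('n)\<close> are the dimensions of the two players.\<close>

definition block_vec :: "'a^'m \<Rightarrow> 'a^'n \<Rightarrow> 'a^('m + 'n)" where
  "block_vec x y = (\<chi> i. case i of Inl p \<Rightarrow> x $ p | Inr q \<Rightarrow> y $ q)"

text \<open>\<open>block_matrix P Q R S\<close> has block rows \<open>P, Q\<close> and \<open>R, S\<close>.\<close>

definition block_matrix ::
    "'a^'m^'m \<Rightarrow> 'a^'n^'m \<Rightarrow> 'a^'m^'n \<Rightarrow> 'a^'n^'n \<Rightarrow> 'a^('m + 'n)^('m + 'n)" where
  "block_matrix P Q R S =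
     (\<chi> i. case i of Inl p \<Rightarrow> block_vec (P $ p) (Q $ p) | Inr q \<Rightarrow> block_vec (R $ q) (S $ q))"

definition symmetric_matrix :: "real^'k^'k \<Rightarrow> bool" where
  "symmetric_matrix A \<longleftrightarrow> transpose A = A"

definition positive_definite :: "real^'k^'k \<Rightarrow> bool" where
  "positive_definite A \<longleftrightarrow> symmetric_matrix A \<and> (\<forall>x. x \<noteq> 0 \<longrightarrow> 0 < x \<bullet> (A *v x))"

text \<open>With \<open>(M, a)\<close> this is the Nash equilibrium, with \<open>(N, b)\<close> the altruistic one.\<close>

definition equilibrium :: "real^'k^'k \<Rightarrow> real^'k \<Rightarrow> real^'k" where
  "equilibrium M a = - (a v* matrix_inv M)"

definition H_matrix :: "real \<Rightarrow> real^('m::finite + 'n::finite)^('m + 'n)" where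
  "H_matrix \<phi> = block_matrix (mat (cos \<phi>)) 0 0 (mat (sin \<phi>))"

definition MHN_matrix ::
    "real^('m::finite + 'n::finite)^('m + 'n) \<Rightarrow>
     real^('m + 'n)^('m + 'n) \<Rightarrow> real \<Rightarrow>
     real^('m + 'n)^('m + 'n)" where
  "MHN_matrix M N \<phi> = M ** matrix_inv (H_matrix \<phi>) ** matrix_inv N"

text \<open>The matrix whose inverse transpose is \<open>G_matrix\<close>. The value of \<open>matrix_inv\<close>
  at a singular matrix is unspecified.\<close>

definition pre_G_matrix ::
    "real^('m::finite + 'n::finite)^('m + 'n) \<Rightarrow>
     real^('m + 'n)^('m + 'n) \<Rightarrow> real \<Rightarrow> real \<Rightarrow>
     real^('m + 'n)^('m + 'n)" where
  "pre_G_matrix M N \<phi> t = (1 / t) *\<^sub>R MHN_matrix M N \<phi> + mat 1"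

definition G_matrix ::
    "real^('m::finite + 'n::finite)^('m + 'n) \<Rightarrow>
     real^('m + 'n)^('m + 'n) \<Rightarrow> real \<Rightarrow> real \<Rightarrow>
     real^('m + 'n)^('m + 'n)" where
  "G_matrix M N \<phi> t = transpose (matrix_inv (pre_G_matrix M N \<phi> t))"

definition Gamma_curve ::
    "real^('m::finite + 'n::finite)^('m + 'n) \<Rightarrow>
     real^('m + 'n)^('m + 'n) \<Rightarrow>
     real^('m + 'n) \<Rightarrow> real^('m + 'n) \<Rightarrow> real \<Rightarrow> real \<Rightarrow>
     real^('m + 'n)" where
  "Gamma_curve M N a b \<phi> t =
     equilibrium M a + G_matrix M N \<phi> t *v (equilibrium N b - equilibrium M a)"

definition cvec :: "real^'k \<Rightarrow> complex^'k" where
  "cvec x = (\<chi> i. complex_of_real (x $ i))"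

text \<open>Families indexed by \<open>{1..CARD('k)}\<close>: a basis \<open>V\<close> of right eigenvectors over the complex
  numbers, and left eigenvectors \<open>W\<close> dual to it. The pairing \<open>scalar_product\<close> is bilinear
  (no complex conjugation).\<close>

definition eigensystem ::
    "real^'k^'k \<Rightarrow> (nat \<Rightarrow> complex) \<Rightarrow> (nat \<Rightarrow> complex^'k) \<Rightarrow> (nat \<Rightarrow> complex^'k) \<Rightarrow> bool" where
  "eigensystem K eig V W \<longleftrightarrow>
     (\<forall>i\<in>{1..CARD('k)}. map_matrix complex_of_real K *v V i = eig i *s V i) \<and>
     inj_on V {1..CARD('k)} \<and>
     vec.independent (V ` {1..CARD('k)}) \<and> vec.span (V ` {1..CARD('k)}) = UNIV \<and>
     (\<forall>i\<in>{1..CARD('k)}. W i v* map_matrix complex_of_real K = eig i *s W i) \<and>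
     (\<forall>i\<in>{1..CARD('k)}. \<forall>k\<in>{1..CARD('k)}.
        scalar_product (W i) (V k) = (if i = k then 1 else 0))"

end

theory Submission
  imports Defs
begin

text \<open>
  The idea is to read \<open>G(t)\<close> in the coordinates given by the eigenvectors. With
  \<open>K = M H\<inverse> N\<inverse>\<close>, the vector \<open>y = G(t) x\<close> is the solution of \<open>y v* (K / t + I) = x\<close>.
  Pairing this equation with a right eigenvector \<open>V i\<close> decouples it into the scalar equation
  \<open>(1 + eig i / t) * (V i \<cdot> y) = V i \<cdot> x\<close>, so each coordinate of \<open>y\<close> is a coordinate of \<open>x\<close>
  divided by \<open>1 + eig i / t\<close>. Since the \<open>V i\<close> span the space and the \<open>W i\<close> are dual to them,
  the numbers \<open>V i \<cdot> y\<close> are the coefficients of \<open>y\<close> with respect to the \<open>W i\<close>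
  (\<open>left_eigenvector_expansion\<close>), and this turns the scalar equations into an explicit formula
  (\<open>resolvent_expansion\<close>).

  As \<open>t\<close> tends to \<open>r = |eig j| = - eig j\<close>, the factor \<open>1 + eig i / t\<close> tends to zero exactly for
  those \<open>i\<close> with \<open>eig i = eig j\<close>. Their terms all carry the same scalar factor and make up the
  subtracted singular term; the remaining terms converge to \<open>ufin\<close>
  (\<open>resolvent_asymptotics\<close>). The matrix \<open>K / t + I\<close> is singular only at the values
  \<open>t = - eig i\<close>, finitely many in number, so it is invertible in a punctured neighbourhood
  of \<open>r\<close>.
\<close>

lemma scalar_product_commute:
  fixes x y :: "'a::comm_semiring_1^'k"
  shows "scalar_product x y = scalar_product y x"
  by (simp add: scalar_product_def mult.commute)

lemma scalar_product_diff_right: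
  fixes x y z :: "'a::comm_ring_1^'k"
  shows "scalar_product x (y - z) = scalar_product x y - scalar_product x z"
  by (simp add: scalar_product_def algebra_simps sum_subtractf)

lemma scalar_product_scale_right:
  fixes x y :: "'a::comm_semiring_1^'k"
  shows "scalar_product x (c *s y) = c * scalar_product x y"
  by (simp add: scalar_product_def sum_distrib_left mult_ac)

lemma scalar_product_sum_right:
  fixes x :: "'a::comm_semiring_1^'k"
  shows "scalar_product x (\<Sum>i\<in>S. f i) = (\<Sum>i\<in>S. scalar_product x (f i))"
  by (simp add: scalar_product_def sum_distrib_left sum.swap[of _ S])

lemma scalar_product_vector_matrix:
  fixes A :: "'a::comm_semiring_1^'k^'k"
  shows "scalar_product x (y v* A) = scalar_product (A *v x) y"
  by (simp add: scalar_product_def vector_matrix_mult_def matrix_vector_mult_def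
      sum_distrib_left sum_distrib_right mult_ac) (rule sum.swap)

lemma eq_zero_if_scalar_product_spanning_zero:
  fixes y :: "'a::field^'k"
  assumes span: "vec.span S = UNIV" and zero: "\<And>v. v \<in> S \<Longrightarrow> scalar_product v y = 0"
  shows "y = 0"
proof -
  have all_zero: "scalar_product x y = 0" for x
  proof -
    have "x \<in> vec.span S"
      by (simp add: span)
    then show ?thesis
    proof (induction rule: vec.span_induct_alt)
      case base
      show ?case
        by (simp add: scalar_product_def)
    next
      case (step c v z)
      then show ?case
        using zero[of v]
        by (simp add: scalar_product_def distrib_right sum.distrib mult.assoc
            flip: sum_distrib_left)
    qed
  qed
  have "y $ k = 0" for k
    using all_zero[of "axis k 1"]
    by (simp add: scalar_product_def axis_def if_distrib[of "\<lambda>z. z * _"] cong: if_cong)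
  then show ?thesis
    by (simp add: vec_eq_iff)
qed

lemma cvec_0 [simp]: "cvec 0 = 0"
  by (simp add: cvec_def vec_eq_iff)

lemma cvec_eq_0_iff [simp]: "cvec x = 0 \<longleftrightarrow> x = 0"
  by (simp add: cvec_def vec_eq_iff)

lemma cvec_add: "cvec (x + y) = cvec x + cvec y"
  by (simp add: cvec_def vec_eq_iff)

lemma cvec_vector_matrix: "cvec (x v* A) = cvec x v* map_matrix complex_of_real A"
  by (simp add: cvec_def vec_eq_iff vector_matrix_mult_def map_matrix_def)

text \<open>The pairings with the \<open>V i\<close> are the coefficients of a vector with respect to the \<open>W i\<close>:
  by duality, the difference of the two sides pairs to zero with every \<open>V k\<close>, and these
  vectors span the space.\<close>

lemma left_eigenvector_expansion:
  fixes K :: "real^'k^'k"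
  assumes "eigensystem K eig V W"
  shows "(\<Sum>i\<in>{1..CARD('k)}. scalar_product (V i) x *s W i) = x"
proof -
  let ?I = "{1..CARD('k)}"
  let ?s = "\<Sum>i\<in>?I. scalar_product (V i) x *s W i"
  have "scalar_product (V k) (?s - x) = 0" if "k \<in> ?I" for k
  proof -
    have "scalar_product (V k) ?s = (\<Sum>i\<in>?I. scalar_product (V i) x * (if i = k then 1 else 0))"
      unfolding scalar_product_sum_right
      using assms that
      by (intro sum.cong)
        (simp_all add: eigensystem_def scalar_product_scale_right scalar_product_commute[of "V k"])
    also have "\<dots> = scalar_product (V k) x"
      using that by (simp add: if_distrib[of "\<lambda>z. _ * z"] cong: if_cong)
    finally show ?thesis
      by (simp add: scalar_product_diff_right)
  qed
  then have "?s - x = 0"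
    using assms unfolding eigensystem_def
    by (intro eq_zero_if_scalar_product_spanning_zero[of "V ` ?I"]) auto
  then show ?thesis
    by simp
qed

text \<open>This is the decoupling: pairing with a right eigenvector of \<open>K\<close> turns the action of
  \<open>K / t + I\<close> on row vectors into multiplication by a scalar.\<close>

lemma scalar_product_eigenvector_resolvent:
  fixes K :: "real^'k^'k"
  assumes "map_matrix complex_of_real K *v v = l *s v"
  shows "scalar_product v (cvec (y v* ((1 / t) *\<^sub>R K + mat 1)))
    = (1 + l / complex_of_real t) * scalar_product v (cvec y)"
proof -
  have "map_matrix complex_of_real ((1 / t) *\<^sub>R K + mat 1) *v v
    = complex_of_real (1 / t) *s (map_matrix complex_of_real K *v v) + v"
    by (simp add: vec_eq_iff matrix_vector_mult_def map_matrix_def mat_def sum_distrib_left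
        if_distrib[of complex_of_real] if_distrib[of "\<lambda>z. z * _"] distrib_right sum.distrib
        mult.assoc cong: if_cong)
  also have "\<dots> = (1 + l / complex_of_real t) *s v"
    by (simp add: assms vec_eq_iff algebra_simps)
  finally show ?thesis
    unfolding cvec_vector_matrix scalar_product_vector_matrix
    by (simp only: scalar_product_commute[of _ "cvec y"] scalar_product_scale_right)
qed

text \<open>The right eigenvectors detect the zero vector by pairing, so the decoupled equations give
  injectivity of the action on row vectors, that is, of the transpose.\<close>

lemma invertible_resolvent:
  fixes K :: "real^'k^'k"
  assumes eigensystem: "eigensystem K eig V W"
    and nonzero: "\<And>i. i \<in> {1..CARD('k)} \<Longrightarrow> 1 + eig i / complex_of_real t \<noteq> 0"
  shows "invertible ((1 / t) *\<^sub>R K + mat 1)"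
proof -
  let ?I = "{1..CARD('k)}"
  let ?P = "(1 / t) *\<^sub>R K + mat 1"
  have "y = 0" if y: "transpose ?P *v y = 0" for y
  proof -
    have "scalar_product (V i) (cvec y) = 0" if "i \<in> ?I" for i
      using scalar_product_eigenvector_resolvent[of K "V i" "eig i" y t] eigensystem nonzero[OF that]
        that y
      by (simp add: eigensystem_def scalar_product_def)
    then have "cvec y = 0"
      using eigensystem unfolding eigensystem_def
      by (intro eq_zero_if_scalar_product_spanning_zero[of "V ` ?I"]) auto
    then show ?thesis
      by simp
  qed
  then have "invertible (transpose ?P)"
    by (auto simp: invertible_left_inverse matrix_left_invertible_ker)
  then show ?thesis
    using transpose_invertible by fastforce
qed

lemma resolvent_expansion:
  fixes K :: "real^'k^'k"
  assumes eigensystem: "eigensystem K eig V W"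
    and nonzero: "\<And>i. i \<in> {1..CARD('k)} \<Longrightarrow> 1 + eig i / complex_of_real t \<noteq> 0"
  shows "cvec (transpose (matrix_inv ((1 / t) *\<^sub>R K + mat 1)) *v x)
    = (\<Sum>i\<in>{1..CARD('k)}.
        (inverse (1 + eig i / complex_of_real t) * scalar_product (V i) (cvec x)) *s W i)"
proof -
  let ?I = "{1..CARD('k)}"
  let ?P = "(1 / t) *\<^sub>R K + mat 1"
  define y where "y = transpose (matrix_inv ?P) *v x"
  have "matrix_inv ?P ** ?P = mat 1"
    using someI_ex[OF invertible_resolvent[OF eigensystem nonzero, unfolded invertible_def]]
    by (simp add: matrix_inv_def)
  then have "y v* ?P = x"
    by (simp add: y_def vector_matrix_mul_assoc)
  then have "(1 + eig i / complex_of_real t) * scalar_product (V i) (cvec y)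
    = scalar_product (V i) (cvec x)" if "i \<in> ?I" for i
    using scalar_product_eigenvector_resolvent[of K "V i" "eig i" y t] eigensystem that
    by (simp add: eigensystem_def)
  then have "scalar_product (V i) (cvec y)
    = inverse (1 + eig i / complex_of_real t) * scalar_product (V i) (cvec x)" if "i \<in> ?I" for i
    using nonzero[OF that] that by (metis mult.assoc mult.left_neutral left_inverse)
  then show ?thesis
    using left_eigenvector_expansion[OF eigensystem, of "cvec y"] by (simp add: y_def)
qed

lemma tendsto_one_plus_divide:
  assumes "r \<noteq> 0"
  shows "((\<lambda>t. 1 + l / complex_of_real t) \<longlongrightarrow> 1 + l / complex_of_real r) (at r)"
  using assms by (auto intro!: tendsto_eq_intros)

lemma eventually_one_plus_divide_nonzero:
  assumes "r \<noteq> 0"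
  shows "\<forall>\<^sub>F t in at r. 1 + l / complex_of_real t \<noteq> 0"
proof (cases "l = - complex_of_real r")
  case True
  \<comment> \<open>The factor tends to zero here, but it vanishes only at \<open>r\<close> itself.\<close>
  have "\<forall>\<^sub>F t in at r. t \<noteq> r \<and> t \<noteq> 0"
    using assms by (intro eventually_conj eventually_neq_at_within)
  then show ?thesis
    by eventually_elim (auto simp: True field_simps)
next
  case False
  then have "1 + l / complex_of_real r \<noteq> 0"
    using assms by (auto simp: field_simps add_eq_0_iff)
  then show ?thesis
    using tendsto_one_plus_divide[OF assms] tendsto_imp_eventually_ne by blast
qed

text \<open>In the expansion of the resolvent, the terms whose eigenvalue is \<open>- r\<close> share the factor
  \<open>1 - r / t\<close> and cancel exactly against the subtracted term; every other term is continuous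
  at \<open>r\<close>.\<close>

lemma resolvent_asymptotics:
  fixes K :: "real^'k^'k"
  assumes eigensystem: "eigensystem K eig V W"
    and r: "r \<noteq> 0"
    and J: "J = {i \<in> {1..CARD('k)}. eig i = - complex_of_real r}"
  shows "\<forall>\<^sub>F t in at r. invertible ((1 / t) *\<^sub>R K + mat 1)"
    and "((\<lambda>t. cvec (transpose (matrix_inv ((1 / t) *\<^sub>R K + mat 1)) *v x)
            - inverse (1 - complex_of_real r / complex_of_real t) *s
              (\<Sum>i\<in>J. scalar_product (V i) (cvec x) *s W i))
          \<longlongrightarrow> (\<Sum>i\<in>{1..CARD('k)} - J.
            (inverse (1 + eig i / complex_of_real r) * scalar_product (V i) (cvec x)) *s W i)) (at r)"
proof -
  let ?I = "{1..CARD('k)}"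
  let ?term = "\<lambda>t i. (inverse (1 + eig i / complex_of_real t) * scalar_product (V i) (cvec x)) *s W i"
  have nonzero: "\<forall>\<^sub>F t in at r. \<forall>i\<in>?I. 1 + eig i / complex_of_real t \<noteq> 0"
    by (intro eventually_ball_finite ballI eventually_one_plus_divide_nonzero r) simp
  then show "\<forall>\<^sub>F t in at r. invertible ((1 / t) *\<^sub>R K + mat 1)"
    by eventually_elim (rule invertible_resolvent[OF eigensystem], blast)
  have "\<forall>\<^sub>F t in at r. (\<Sum>i\<in>?I - J. ?term t i) =
      cvec (transpose (matrix_inv ((1 / t) *\<^sub>R K + mat 1)) *v x)
        - inverse (1 - complex_of_real r / complex_of_real t) *s
          (\<Sum>i\<in>J. scalar_product (V i) (cvec x) *s W i)"
    using nonzero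
  proof eventually_elim
    case (elim t)
    have "cvec (transpose (matrix_inv ((1 / t) *\<^sub>R K + mat 1)) *v x) = (\<Sum>i\<in>?I. ?term t i)"
      using elim by (intro resolvent_expansion[OF eigensystem]) blast
    also have "\<dots> = (\<Sum>i\<in>?I - J. ?term t i) + (\<Sum>i\<in>J. ?term t i)"
      by (intro sum.subset_diff) (auto simp: J)
    also have "(\<Sum>i\<in>J. ?term t i) = inverse (1 - complex_of_real r / complex_of_real t) *s
        (\<Sum>i\<in>J. scalar_product (V i) (cvec x) *s W i)"
      by (simp add: J vec.scale_sum_right)
    finally show ?case
      by simp
  qed
  moreover have "((\<lambda>t. \<Sum>i\<in>?I - J. ?term t i) \<longlongrightarrow> (\<Sum>i\<in>?I - J. ?term r i)) (at r)"
  proof (intro tendsto_sum vec_tendstoI)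
    fix i k
    assume "i \<in> ?I - J"
    then have "1 + eig i / complex_of_real r \<noteq> 0"
      using r by (auto simp: J field_simps add_eq_0_iff)
    then show "((\<lambda>t. ?term t i $ k) \<longlongrightarrow> ?term r i $ k) (at r)"
      unfolding vector_smult_component
      by (intro tendsto_mult tendsto_inverse tendsto_const tendsto_one_plus_divide r)
  qed
  ultimately show "((\<lambda>t. cvec (transpose (matrix_inv ((1 / t) *\<^sub>R K + mat 1)) *v x)
            - inverse (1 - complex_of_real r / complex_of_real t) *s
              (\<Sum>i\<in>J. scalar_product (V i) (cvec x) *s W i))
          \<longlongrightarrow> (\<Sum>i\<in>?I - J. ?term r i)) (at r)"
    by (rule Lim_transform_eventually[rotated])
qed

theorem proposition7:
  fixes A1 D2 :: "real^'m^'m" and A2 D1 :: "real^'n^'n"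
    and B1 :: "real^'m^'n" and B2 :: "real^'n^'m"
    and a1 b2 :: "real^'m" and a2 b1 :: "real^'n"
    and M1 M2 M N :: "real^('m + 'n)^('m + 'n)" and a b uN uA :: "real^('m + 'n)"
    and \<phi> :: real
    and eig :: "nat \<Rightarrow> complex" and V W :: "nat \<Rightarrow> complex^('m + 'n)"
    and d j :: nat and J :: "nat set" and ufin uinf :: "complex^('m + 'n)"
  assumes M1: "M1 = block_matrix A1 (transpose B1) B1 D1"
    and M2: "M2 = block_matrix D2 B2 (transpose B2) A2"
    and M: "M = block_matrix A1 B2 B1 A2"
    and N: "N = block_matrix D2 (transpose B1) (transpose B2) D1"
    and a: "a = block_vec a1 a2"
    and b: "b = block_vec b2 b1"
    and symmetric: "symmetric_matrix M1" "symmetric_matrix M2"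
    and pos_def: "positive_definite A1" "positive_definite A2"
    and invertible: "invertible M1" "invertible M2" "invertible M" "invertible N"
    and uN: "uN = equilibrium M a"
    and uA: "uA = equilibrium N b"
    and phi: "0 < \<phi>" "\<phi> < pi / 2"
    and d: "d = CARD('m) + CARD('n)"
    and eigensystem: "eigensystem (MHN_matrix M N \<phi>) eig V W"
    and j: "j \<in> {1..d}"
    and negative: "eig j \<in> \<real>" "Re (eig j) < 0"
    and J: "J = {i \<in> {1..d}. eig i = eig j}"
    and ufin: "ufin = (\<Sum>i\<in>{1..d} - J.
      (inverse (1 + eig i / complex_of_real (cmod (eig j))) * scalar_product (V i) (cvec (uA - uN))) *s W i)"
    and uinf: "uinf = (\<Sum>i\<in>J. scalar_product (V i) (cvec (uA - uN)) *s W i)"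
  shows "(\<forall>\<^sub>F t in at (cmod (eig j)). invertible (pre_G_matrix M N \<phi> t)) \<and>
    ((\<lambda>t. cvec (Gamma_curve M N a b \<phi> t) - inverse (1 + eig j / complex_of_real t) *s uinf)
      \<longlongrightarrow> cvec uN + ufin) (at (cmod (eig j)))"
proof -
  define r where "r = cmod (eig j)"
  obtain e where e: "eig j = complex_of_real e"
    using negative(1) by (auto elim: Reals_cases)
  then have eig_j: "eig j = - complex_of_real r" and "0 < r"
    using negative(2) by (simp_all add: r_def)
  have dim: "d = CARD('m + 'n)"
    by (simp add: d)
  have J': "J = {i \<in> {1..CARD('m + 'n)}. eig i = - complex_of_real r}"
    by (simp add: J dim flip: eig_j)
  have "r \<noteq> 0"
    using \<open>0 < r\<close> by simp
  note asymptotics = resolvent_asymptotics[OF eigensystem this J']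
  have "\<forall>\<^sub>F t in at r. invertible (pre_G_matrix M N \<phi> t)"
    using asymptotics(1) by (simp add: pre_G_matrix_def)
  moreover have "((\<lambda>t. cvec (Gamma_curve M N a b \<phi> t) - inverse (1 + eig j / complex_of_real t) *s uinf)
      \<longlongrightarrow> cvec uN + ufin) (at r)"
    using tendsto_add[OF tendsto_const[of "cvec uN"] asymptotics(2)[of "uA - uN"]]
    by (simp add: Gamma_curve_def G_matrix_def pre_G_matrix_def cvec_add uinf ufin dim eig_j
        abs_of_pos[OF \<open>0 < r\<close>] add_diff_eq flip: uN uA r_def)
  ultimately show ?thesis
    by (simp add: r_def)
qed

end
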